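(* Let $K$ be a Krein space, let $\{f_n\}_{n\in\mathbb{N}}$ be any $J$-frame for $K$, and let $\{m_k\}$, $\{n_k\}$ be two infinite increasing sequences with $\{m_k\}\cup\{n_k\}=\mathbb{N}$. Let $K'=\overline{\mathrm{span}}\{f_{m_k}\}\cap\overline{\mathrm{span}}\{f_{n_k}\}$. If $K'$ is a finite dimensional Krein space (with the form $[\cdot,\cdot]$ restricted to $K'$), then $\{f_{m_k}\}$ and $\{f_{n_k}\}$ are $J$-frame sequences for $K$.
   Context: A Krein space $(K,[\cdot,\cdot])$ is a vector space over $F=\mathbb{R}$ or $\mathbb{C}$ with a form $[\cdot,\cdot]$, linear in the first variable and satisfying $[y,x]=\overline{[x,y]}$, that admits a canonical decomposition $K=K^+[\dot{+}]K^-$ (direct, $[\cdot,\cdot]$-orthogonal) such that $(K^+,[\cdot,\cdot])$ and $(K^-,-[\cdot,\cdot])$ are Hilbert spaces. If $P^{\pm}$ are the projections of $K$ onto $K^{\pm}$ of this decomposition, the fundamental (canonical) symmetry is $J=P^+-P^-$, and $[x,y]_J=[x,Jy]$ is a Hilbert space inner product on $K$ with norm $\|\cdot\|_J$ (the associated Hilbert space). All topological notions refer to $\|\cdot\|_J$. A subspace $M$ is uniformly $J$-positive if there is $\epsilon>0$ with $[x,x]\ge\epsilon\|x\|_J^2$ for all $x\in M$, and uniformly $J$-negative if there is $\epsilon>0$ with $-[x,x]\ge\epsilon\|x\|_J^2$ for all $x\in M$. The subspace $\{0\}$ is both. "Maximal" means maximal under inclusion among subspaces with the given property. $J$-frame: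 let $\{f_i\}_{i\in I}$ ($I$ countable) be a Bessel sequence in $K$ (i.e. Bessel in the associated Hilbert space), with bounded synthesis operator $T:\ell^2(I)\to K$, $T(c_i)=\sum_i c_if_i$. Put $I_+=\{i:[f_i,f_i]\ge 0\}$, $I_-=\{i:[f_i,f_i]<0\}$, let $P_{\pm}$ be the orthogonal projection of $\ell^2(I)$ onto $\ell^2(I_{\pm})$, and $T_{\pm}=TP_{\pm}$. Then $\{f_i\}$ is a $J$-frame for $K$ if the range $R(T_+)$ is a maximal uniformly $J$-positive subspace of $K$ and $R(T_-)$ is a maximal uniformly $J$-negative subspace of $K$. $J$-frame sequence: a Bessel sequence $\{h_i\}_{i\in I}$ in $K$ having no nonzero neutral elements (no $h_i\ne0$ with $[h_i,h_i]=0$) is a $J$-frame sequence for (in) $K$ if $\overline{\mathrm{span}}\{h_i:[h_i,h_i]>0\}$ is a uniformly $J$-positive subspace of $K$ and $\overline{\mathrm{span}}\{h_i:[h_i,h_i]<0\}$ is a uniformly $J$-negative subspace of $K$. *)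

theory Defs
  imports "HOL-Analysis.Analysis"
begin

(* The scalar field F is the real or the complex field: a normed field together with an isometric
   field embedding into the complex numbers whose range is one of these two fields. *)
class real_or_complex = real_normed_field +
  fixes to_complex :: "'a \<Rightarrow> complex"
  assumes to_complex_add: "to_complex (x + y) = to_complex x + to_complex y"
    and to_complex_mult: "to_complex (x * y) = to_complex x * to_complex y"
    and to_complex_scaleR: "to_complex (scaleR r x) = scaleR r (to_complex x)"
    and norm_to_complex: "norm (to_complex x) = norm x"
    and range_to_complex: "range to_complex = \<real> \<or> range to_complex = UNIV"

instantiation real :: real_or_complex
begin
definition to_complex_real :: "real \<Rightarrow> complex" where "to_complex_real = complex_of_real"
instance
  by standard (auto simp: to_complex_real_def Reals_def scaleR_conv_of_real)
end

instantiation complex :: real_or_complex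
begin
definition to_complex_complex :: "complex \<Rightarrow> complex" where "to_complex_complex = (\<lambda>z. z)"
instance
  by standard (auto simp: to_complex_complex_def)
end

definition conjugate :: "'a::real_or_complex \<Rightarrow> 'a" where
  "conjugate x = inv to_complex (cnj (to_complex x))"

definition re :: "'a::real_or_complex \<Rightarrow> real" where
  "re x = Re (to_complex x)"

lemma conjugate_real: "conjugate (x::real) = x"
  by (simp add: conjugate_def to_complex_real_def inv_f_f inj_def)

lemma conjugate_complex: "conjugate (z::complex) = cnj z"
  by (simp add: conjugate_def to_complex_complex_def inv_f_f inj_def)

lemma re_real: "re (x::real) = x"
  by (simp add: re_def to_complex_real_def)

lemma re_complex: "re (z::complex) = Re z"
  by (simp add: re_def to_complex_complex_def)

(* Below, S is a subspace of the ambient vector space and B a form on it. By hermitian symmetry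
   B x x is real, so statements about its sign are statements about its real part. *)

definition hermitian_form_on ::
    "('f::real_or_complex \<Rightarrow> 'v::ab_group_add \<Rightarrow> 'v) \<Rightarrow> ('v \<Rightarrow> 'v \<Rightarrow> 'f) \<Rightarrow> 'v set \<Rightarrow> bool" where
  "hermitian_form_on scl B S \<longleftrightarrow>
     (\<forall>x\<in>S. \<forall>y\<in>S. \<forall>z\<in>S. B (x + y) z = B x z + B y z) \<and>
     (\<forall>a. \<forall>x\<in>S. \<forall>y\<in>S. B (scl a x) y = a * B x y) \<and>
     (\<forall>x\<in>S. \<forall>y\<in>S. B y x = conjugate (B x y))"

definition hilbert_space_on ::
    "('f::real_or_complex \<Rightarrow> 'v::ab_group_add \<Rightarrow> 'v) \<Rightarrow> ('v \<Rightarrow> 'v \<Rightarrow> 'f) \<Rightarrow> 'v set \<Rightarrow> bool" where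
  "hilbert_space_on scl B S \<longleftrightarrow>
     module.subspace scl S \<and> hermitian_form_on scl B S \<and>
     (\<forall>x\<in>S. x \<noteq> 0 \<longrightarrow> 0 < re (B x x)) \<and>
     Metric_space.mcomplete S (\<lambda>x y. sqrt (re (B (x - y) (x - y))))"

definition canonical_decomposition ::
    "('f::real_or_complex \<Rightarrow> 'v::ab_group_add \<Rightarrow> 'v) \<Rightarrow> ('v \<Rightarrow> 'v \<Rightarrow> 'f) \<Rightarrow> 'v set \<Rightarrow>
     'v set \<Rightarrow> 'v set \<Rightarrow> bool" where
  "canonical_decomposition scl B S Sp Sm \<longleftrightarrow>
     S = {x + y | x y. x \<in> Sp \<and> y \<in> Sm} \<and> Sp \<inter> Sm = {0} \<and>
     (\<forall>x\<in>Sp. \<forall>y\<in>Sm. B x y = 0) \<and>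
     hilbert_space_on scl B Sp \<and> hilbert_space_on scl (\<lambda>x y. - B x y) Sm"

definition krein_space_on ::
    "('f::real_or_complex \<Rightarrow> 'v::ab_group_add \<Rightarrow> 'v) \<Rightarrow> ('v \<Rightarrow> 'v \<Rightarrow> 'f) \<Rightarrow> 'v set \<Rightarrow> bool" where
  "krein_space_on scl B S \<longleftrightarrow>
     module.subspace scl S \<and> hermitian_form_on scl B S \<and>
     (\<exists>Sp Sm. canonical_decomposition scl B S Sp Sm)"

(* A Krein space together with the canonical decomposition that determines its associated
   Hilbert space. *)
locale krein_space = vector_space scl
  for scl :: "'f::real_or_complex \<Rightarrow> 'v::ab_group_add \<Rightarrow> 'v" +
  fixes form :: "'v \<Rightarrow> 'v \<Rightarrow> 'f" and Kp Km :: "'v set"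
  assumes hermitian_form: "hermitian_form_on scl form UNIV"
    and canonical_decomposition: "canonical_decomposition scl form UNIV Kp Km"
begin

definition proj_plus :: "'v \<Rightarrow> 'v" where
  "proj_plus x = (THE p. p \<in> Kp \<and> x - p \<in> Km)"

definition proj_minus :: "'v \<Rightarrow> 'v" where
  "proj_minus x = (THE q. q \<in> Km \<and> x - q \<in> Kp)"

definition fund_sym :: "'v \<Rightarrow> 'v" where
  "fund_sym x = proj_plus x - proj_minus x"

definition J_inner :: "'v \<Rightarrow> 'v \<Rightarrow> 'f" where
  "J_inner x y = form x (fund_sym y)"

definition J_norm :: "'v \<Rightarrow> real" where
  "J_norm x = sqrt (re (J_inner x x))"

definition J_topology :: "'v topology" where
  "J_topology = Metric_space.mtopology UNIV (\<lambda>x y. J_norm (x - y))"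

definition closed_span :: "'v set \<Rightarrow> 'v set" where
  "closed_span A = J_topology closure_of (span A)"

definition uniformly_positive :: "'v set \<Rightarrow> bool" where
  "uniformly_positive M \<longleftrightarrow>
     subspace M \<and> (\<exists>\<epsilon>>0. \<forall>x\<in>M. re (form x x) \<ge> \<epsilon> * (J_norm x)\<^sup>2)"

definition uniformly_negative :: "'v set \<Rightarrow> bool" where
  "uniformly_negative M \<longleftrightarrow>
     subspace M \<and> (\<exists>\<epsilon>>0. \<forall>x\<in>M. - re (form x x) \<ge> \<epsilon> * (J_norm x)\<^sup>2)"

definition maximal_uniformly_positive :: "'v set \<Rightarrow> bool" where
  "maximal_uniformly_positive M \<longleftrightarrow>
     uniformly_positive M \<and> (\<forall>N. uniformly_positive N \<and> M \<subseteq> N \<longrightarrow> N = M)"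

definition maximal_uniformly_negative :: "'v set \<Rightarrow> bool" where
  "maximal_uniformly_negative M \<longleftrightarrow>
     uniformly_negative M \<and> (\<forall>N. uniformly_negative N \<and> M \<subseteq> N \<longrightarrow> N = M)"

definition bessel :: "(nat \<Rightarrow> 'v) \<Rightarrow> bool" where
  "bessel f \<longleftrightarrow>
     (\<exists>C. \<forall>x. summable (\<lambda>i. (norm (J_inner x (f i)))\<^sup>2) \<and>
              (\<Sum>i. (norm (J_inner x (f i)))\<^sup>2) \<le> C * (J_norm x)\<^sup>2)"

definition ell2 :: "(nat \<Rightarrow> 'f) set" where
  "ell2 = {c. summable (\<lambda>i. (norm (c i))\<^sup>2)}"

(* The orthogonal projection of ell2 onto the sequences supported in A. *)
definition coord_proj :: "nat set \<Rightarrow> (nat \<Rightarrow> 'f) \<Rightarrow> (nat \<Rightarrow> 'f)" where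
  "coord_proj A c = (\<lambda>i. if i \<in> A then c i else 0)"

(* Only used for Bessel f and c in ell2, where the series converges in J-norm. *)
definition synthesis :: "(nat \<Rightarrow> 'v) \<Rightarrow> (nat \<Rightarrow> 'f) \<Rightarrow> 'v" where
  "synthesis f c =
     (THE x. limitin J_topology (\<lambda>N. \<Sum>i<N. scl (c i) (f i)) x sequentially)"

definition I_plus :: "(nat \<Rightarrow> 'v) \<Rightarrow> nat set" where
  "I_plus f = {i. re (form (f i) (f i)) \<ge> 0}"

definition I_minus :: "(nat \<Rightarrow> 'v) \<Rightarrow> nat set" where
  "I_minus f = {i. re (form (f i) (f i)) < 0}"

definition J_frame :: "(nat \<Rightarrow> 'v) \<Rightarrow> bool" where
  "J_frame f \<longleftrightarrow>
     bessel f \<and>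
     maximal_uniformly_positive ((synthesis f \<circ> coord_proj (I_plus f)) ` ell2) \<and>
     maximal_uniformly_negative ((synthesis f \<circ> coord_proj (I_minus f)) ` ell2)"

definition J_frame_sequence :: "(nat \<Rightarrow> 'v) \<Rightarrow> bool" where
  "J_frame_sequence h \<longleftrightarrow>
     bessel h \<and>
     \<not> (\<exists>i. h i \<noteq> 0 \<and> form (h i) (h i) = 0) \<and>
     uniformly_positive (closed_span {h i | i. re (form (h i) (h i)) > 0}) \<and>
     uniformly_negative (closed_span {h i | i. re (form (h i) (h i)) < 0})"

end

end

theory Submission
  imports Defs
begin

text \<open>Every frame vector with nonnegative square lies in the range of the positive part of the
  synthesis operator, and every other one in the range of the negative part, as images of the
  coordinate sequences. These ranges are definite, which excludes nonzero neutral vectors, and the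
  form is bounded with respect to the \<open>J\<close>-norm, so that uniform definiteness passes to closures.\<close>

section \<open>The scalar field inside the complex numbers\<close>

lemma to_complex_diff: "to_complex (x - y) = to_complex x - to_complex (y::'a::real_or_complex)"
  using to_complex_add[of "x - y" y] by simp

lemma to_complex_0: "to_complex (0::'a::real_or_complex) = 0"
  using norm_to_complex[of "0::'a"] by simp

text \<open>The range of the embedding is the real line or the whole complex plane. Both are closed
  under \<open>cnj\<close>, so the inverse in \<open>conjugate\<close> is taken at a point of the
  range.\<close>

lemma to_complex_conjugate:
  "to_complex (conjugate (x::'a::real_or_complex)) = cnj (to_complex x)"
proof -
  have "cnj (to_complex x) \<in> range (to_complex :: 'a \<Rightarrow> complex)"
    using range_to_complex[where ?'a='a] by (metis Reals_cnj_iff UNIV_I rangeI)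
  then show ?thesis
    unfolding conjugate_def by (rule f_inv_into_f)
qed

lemma re_add: "re (x + y) = re x + re (y::'a::real_or_complex)"
  by (simp add: re_def to_complex_add)

lemma re_diff: "re (x - y) = re x - re (y::'a::real_or_complex)"
  by (simp add: re_def to_complex_diff)

lemma re_conjugate: "re (conjugate (x::'a::real_or_complex)) = re x"
  by (simp add: re_def to_complex_conjugate)

lemma re_0: "re (0::'a::real_or_complex) = 0"
  by (simp add: re_def to_complex_0)

lemma re_of_real_mult: "re (of_real r * (x::'a::real_or_complex)) = r * re x"
  by (simp add: re_def to_complex_scaleR flip: scaleR_conv_of_real)

context krein_space
begin

section \<open>Algebra of the indefinite form\<close>

lemma form_add_left: "form (x + y) z = form x z + form y z"
  and form_scale_left: "form (scl a x) y = a * form x y"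
  and form_conjugate: "form y x = conjugate (form x y)"
  using hermitian_form unfolding hermitian_form_on_def by blast+

text \<open>Conjugation disappears under \<open>re\<close>, so hermitian symmetry becomes plain
  symmetry. This is how additivity is carried over to the second argument without handling
  conjugates.\<close>

lemma re_form_commute: "re (form y x) = re (form x y)"
  by (metis form_conjugate re_conjugate)

lemma re_form_add_right: "re (form x (y + z)) = re (form x y) + re (form x z)"
  by (metis form_add_left re_add re_form_commute)

lemma form_diff_left: "form (x - y) z = form x z - form y z"
  using form_add_left[of "x - y" y z] by simp

lemma re_form_diff_right: "re (form x (y - z)) = re (form x y) - re (form x z)"
  by (metis form_diff_left re_diff re_form_commute)

lemma form_0_left: "form 0 y = 0"
  using form_diff_left[of 0 0 y] by simp

text \<open>Hermitian symmetry turns linearity in the first argument into conjugate linearity in the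
  second. The two scalars then combine to a times its conjugate, which is the squared
  modulus.\<close>

lemma re_form_scale_scale: "re (form (scl a x) (scl a y)) = (norm a)\<^sup>2 * re (form x y)"
proof -
  have "form (scl a x) (scl a y) = a * conjugate (a * form y x)"
    by (metis form_conjugate form_scale_left)
  then have "to_complex (form (scl a x) (scl a y))
      = (to_complex a * cnj (to_complex a)) * cnj (to_complex (form y x))"
    by (simp add: to_complex_mult to_complex_conjugate)
  also have "\<dots> = of_real ((norm a)\<^sup>2) * cnj (to_complex (form y x))"
    by (metis complex_norm_square norm_to_complex)
  finally show ?thesis
    using re_form_commute[of x y] by (simp add: re_def)
qed

section \<open>The canonical decomposition and the fundamental symmetry\<close>

lemma hilbert_space_Kp: "hilbert_space_on scl form Kp"
  and hilbert_space_Km: "hilbert_space_on scl (\<lambda>x y. - form x y) Km"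
  and Kp_Int_Km: "Kp \<inter> Km = {0}"
  and sum_Kp_Km: "UNIV = {x + y | x y. x \<in> Kp \<and> y \<in> Km}"
  and form_Kp_Km_ball: "\<forall>x\<in>Kp. \<forall>y\<in>Km. form x y = 0"
  using canonical_decomposition unfolding canonical_decomposition_def
  by - (elim conjE, assumption)+

lemma form_Kp_Km: "x \<in> Kp \<Longrightarrow> y \<in> Km \<Longrightarrow> form x y = 0"
  using form_Kp_Km_ball by blast

lemma subspace_Kp: "subspace Kp" and subspace_Km: "subspace Km"
  using hilbert_space_Kp hilbert_space_Km unfolding hilbert_space_on_def by simp_all

lemma form_Kp_pos: "x \<in> Kp \<Longrightarrow> x \<noteq> 0 \<Longrightarrow> 0 < re (form x x)"
  using hilbert_space_Kp unfolding hilbert_space_on_def by simp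

lemma form_Km_neg: "x \<in> Km \<Longrightarrow> x \<noteq> 0 \<Longrightarrow> re (form x x) < 0"
  using hilbert_space_Km re_diff[of 0 "form x x"] unfolding hilbert_space_on_def
  by (fastforce simp: re_0)

lemma decomposition_cases:
  obtains p q where "x = p + q" "p \<in> Kp" "q \<in> Km"
  using subst[where P="\<lambda>S. x \<in> S", OF sum_Kp_Km UNIV_I] that by blast

lemma decomposition_cases2:
  obtains p q p' q' where "x = p + q" "y = p' + q'" "p \<in> Kp" "q \<in> Km" "p' \<in> Kp" "q' \<in> Km"
proof -
  obtain p q where "x = p + q" "p \<in> Kp" "q \<in> Km"
    by (rule decomposition_cases)
  moreover obtain p' q' where "y = p' + q'" "p' \<in> Kp" "q' \<in> Km"
    by (rule decomposition_cases)
  ultimately show ?thesis by (intro that)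
qed

text \<open>The vector p - p' = q' - q lies in both summands, which meet only in 0.\<close>

lemma decomposition_unique:
  assumes "p + q = p' + q'" "p \<in> Kp" "p' \<in> Kp" "q \<in> Km" "q' \<in> Km"
  shows "p = p' \<and> q = q'"
proof -
  have "p - p' - (q' - q) = p + q - (p' + q')"
    by (simp add: algebra_simps)
  then have eq: "p - p' = q' - q"
    using assms(1) by simp
  have "p - p' \<in> Kp" "q' - q \<in> Km"
    using assms subspace_diff subspace_Kp subspace_Km by blast+
  then have "p - p' \<in> Kp \<inter> Km"
    by (simp add: eq)
  then show ?thesis
    using eq by (simp add: Kp_Int_Km)
qed

text \<open>Uniqueness of the decomposition evaluates the two definite descriptions behind the
  projections. Subsequent computations with \<open>fund_sym\<close> split the vector and use this
  formula.\<close>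

lemma fund_sym_decomposition:
  assumes "p \<in> Kp" "q \<in> Km"
  shows "fund_sym (p + q) = p - q"
proof -
  have "proj_plus (p + q) = p"
    unfolding proj_plus_def
  proof (rule the_equality)
    fix p' assume "p' \<in> Kp \<and> p + q - p' \<in> Km"
    moreover have "p' + (p + q - p') = p + q"
      by (simp add: algebra_simps)
    ultimately show "p' = p"
      using decomposition_unique assms by blast
  qed (use assms in auto)
  moreover have "proj_minus (p + q) = q"
    unfolding proj_minus_def
  proof (rule the_equality)
    fix q' assume "q' \<in> Km \<and> p + q - q' \<in> Kp"
    moreover have "(p + q - q') + q' = p + q"
      by (simp add: algebra_simps)
    ultimately show "q' = q"
      using decomposition_unique assms by blast
  qed (use assms in auto)
  ultimately show ?thesis
    by (simp add: fund_sym_def)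
qed

lemma fund_sym_scale: "fund_sym (scl a x) = scl a (fund_sym x)"
proof -
  obtain p q where x: "x = p + q" "p \<in> Kp" "q \<in> Km"
    by (rule decomposition_cases)
  then have "scl a x = scl a p + scl a q" "scl a p \<in> Kp" "scl a q \<in> Km"
    using subspace_scale subspace_Kp subspace_Km by (simp_all add: scale_right_distrib)
  then show ?thesis
    using x by (simp add: fund_sym_decomposition scale_right_diff_distrib)
qed

lemma fund_sym_fund_sym: "fund_sym (fund_sym x) = x"
proof -
  obtain p q where x: "x = p + q" "p \<in> Kp" "q \<in> Km"
    by (rule decomposition_cases)
  \<comment> \<open>Writing p - q as p + (- q), with - q again in \<open>Km\<close>, makes the
    formula applicable a second time.\<close>
  then have "fund_sym (fund_sym x) = fund_sym (p + - q)"
    by (simp add: fund_sym_decomposition)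
  also have "\<dots> = p - - q"
    using x subspace_neg[OF subspace_Km] by (intro fund_sym_decomposition) blast+
  finally show ?thesis
    using x by simp
qed

text \<open>The mixed terms vanish by orthogonality of \<open>Kp\<close> and \<open>Km\<close>, and
  both sides reduce to Re [p,p'] - Re [q,q'].\<close>

lemma re_form_fund_sym_right: "re (form x (fund_sym y)) = re (form (fund_sym x) y)"
proof -
  obtain p q p' q' where xy: "x = p + q" "y = p' + q'" "p \<in> Kp" "q \<in> Km" "p' \<in> Kp" "q' \<in> Km"
    by (rule decomposition_cases2)
  moreover have "re (form q p') = 0"
    using xy re_form_commute[of q p'] by (simp add: form_Kp_Km re_0)
  ultimately show ?thesis
    by (simp add: fund_sym_decomposition form_add_left form_diff_left re_form_add_right
        re_form_diff_right re_add re_diff form_Kp_Km re_0)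
qed

section \<open>The associated inner product and its norm\<close>

lemma re_J_inner_add_left: "re (J_inner (x + y) z) = re (J_inner x z) + re (J_inner y z)"
  by (simp add: J_inner_def form_add_left re_add)

lemma re_J_inner_commute: "re (J_inner x y) = re (J_inner y x)"
  by (metis J_inner_def re_form_commute re_form_fund_sym_right)

lemma re_J_inner_add_right: "re (J_inner x (y + z)) = re (J_inner x y) + re (J_inner x z)"
  by (metis re_J_inner_add_left re_J_inner_commute)

lemma re_J_inner_scale_left: "re (J_inner (scl (of_real r) x) y) = r * re (J_inner x y)"
  by (simp add: J_inner_def form_scale_left re_of_real_mult)

lemma re_J_inner_scale_right: "re (J_inner x (scl (of_real r) y)) = r * re (J_inner x y)"
  by (metis re_J_inner_scale_left re_J_inner_commute)

text \<open>For x = p + q the inner product is [p,p] - [q,q]. Both contributions are nonnegative,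
  and one is strictly positive because p and q are not both 0.\<close>

lemma re_J_inner_pos:
  assumes "x \<noteq> 0"
  shows "0 < re (J_inner x x)"
proof -
  obtain p q where x: "x = p + q" "p \<in> Kp" "q \<in> Km"
    by (rule decomposition_cases)
  have "re (form q p) = 0"
    using x re_form_commute[of q p] by (simp add: form_Kp_Km re_0)
  then have "re (J_inner x x) = re (form p p) - re (form q q)"
    using x by (simp add: J_inner_def fund_sym_decomposition form_add_left re_form_diff_right
        re_add form_Kp_Km re_0)
  moreover have "re (form p p) \<ge> 0"
    using x form_Kp_pos[of p] by (cases "p = 0") (auto simp: form_0_left re_0)
  moreover have "re (form q q) \<le> 0"
    using x form_Km_neg[of q] by (cases "q = 0") (auto simp: form_0_left re_0)
  moreover have "re (form p p) > 0 \<or> re (form q q) < 0"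
    using x assms form_Kp_pos[of p] form_Km_neg[of q] by (cases "p = 0") auto
  ultimately show ?thesis by linarith
qed

lemma J_inner_0_left: "J_inner 0 x = 0"
  by (simp add: J_inner_def form_0_left)

lemma re_J_inner_nonneg: "0 \<le> re (J_inner x x)"
  using re_J_inner_pos[of x] by (cases "x = 0") (auto simp: J_inner_0_left re_0)

lemma J_norm_nonneg: "0 \<le> J_norm x"
  by (simp add: J_norm_def re_J_inner_nonneg)

lemma J_norm_power2: "(J_norm x)\<^sup>2 = re (J_inner x x)"
  by (simp add: J_norm_def re_J_inner_nonneg)

lemma J_norm_eq_0_iff: "J_norm x = 0 \<longleftrightarrow> x = 0"
  using re_J_inner_pos[of x] by (cases "x = 0") (auto simp: J_norm_def J_inner_0_left re_0)

lemma J_norm_pos: "x \<noteq> 0 \<Longrightarrow> 0 < J_norm x"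
  by (simp add: J_norm_def re_J_inner_pos)

text \<open>The fundamental symmetry commutes with scalars, so the scaling rule for the form carries
  over.\<close>

lemma J_norm_scale: "J_norm (scl a x) = norm a * J_norm x"
  by (simp add: J_norm_def J_inner_def fund_sym_scale re_form_scale_scale real_sqrt_mult)

lemma J_norm_minus: "J_norm (- x) = J_norm x"
  using J_norm_scale[of "- 1" x] by simp

lemma J_norm_minus_commute: "J_norm (x - y) = J_norm (y - x)"
  by (metis J_norm_minus minus_diff_eq)

lemma re_J_inner_le: "re (J_inner x y) \<le> J_norm x * J_norm y"
proof (cases "x = 0 \<or> y = 0")
  case True
  then have "re (J_inner x y) = 0"
    by (metis J_inner_0_left re_0 re_J_inner_commute)
  then show ?thesis
    by (simp add: J_norm_nonneg)
next
  case False
  define a where "a = J_norm x"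
  define b where "b = J_norm y"
  have ab: "a > 0" "b > 0"
    using False J_norm_pos unfolding a_def b_def by blast+
  \<comment> \<open>In b x - a y both terms have norm a b. Its squared norm is therefore 2 a b (a b
    - Re [x,y]_J), and dividing by 2 a b > 0 gives the Cauchy-Schwarz bound.\<close>
  let ?z = "scl (of_real b) x + scl (of_real (- a)) y"
  have "0 \<le> re (J_inner ?z ?z)"
    by (rule re_J_inner_nonneg)
  also have "\<dots> = b * (b * re (J_inner x x) + - a * re (J_inner x y))
      + - a * (b * re (J_inner x y) + - a * re (J_inner y y))"
    unfolding re_J_inner_add_left re_J_inner_add_right re_J_inner_scale_left
      re_J_inner_scale_right re_J_inner_commute[of y x] by (simp add: algebra_simps)
  also have "\<dots> = 2 * (a * b) * (a * b - re (J_inner x y))"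
    unfolding J_norm_power2[symmetric] a_def[symmetric] b_def[symmetric]
    by (simp add: power2_eq_square algebra_simps)
  finally have "0 \<le> a * b - re (J_inner x y)"
    by (intro mult_left_le_imp_le[of "2 * (a * b)" 0]) (simp_all add: ab)
  then show ?thesis by (simp add: a_def b_def)
qed

lemma J_norm_triangle: "J_norm (x + y) \<le> J_norm x + J_norm y"
proof (rule power2_le_imp_le)
  have "(J_norm (x + y))\<^sup>2 = (J_norm x)\<^sup>2 + 2 * re (J_inner x y) + (J_norm y)\<^sup>2"
    using re_J_inner_commute[of y x]
    by (simp add: J_norm_power2 re_J_inner_add_left re_J_inner_add_right)
  also have "\<dots> \<le> (J_norm x + J_norm y)\<^sup>2"
    using re_J_inner_le[of x y] by (simp add: power2_sum)
  finally show "(J_norm (x + y))\<^sup>2 \<le> (J_norm x + J_norm y)\<^sup>2" .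
qed (simp add: J_norm_nonneg)

lemma J_norm_diff_ge: "J_norm x - J_norm y \<le> J_norm (x - y)"
  using J_norm_triangle[of "x - y" y] by simp

sublocale J: Metric_space UNIV "\<lambda>x y. J_norm (x - y)"
proof
  show "J_norm (x - z) \<le> J_norm (x - y) + J_norm (y - z)" for x y z
    using J_norm_triangle[of "x - y" "y - z"] by simp
qed (auto simp: J_norm_nonneg J_norm_minus_commute J_norm_eq_0_iff)

text \<open>As J is an involution, [Jx, JJx] = [Jx, x], whose real part is that of [x, Jx].\<close>

lemma J_norm_fund_sym: "J_norm (fund_sym x) = J_norm x"
  by (simp add: J_norm_def J_inner_def fund_sym_fund_sym re_form_commute)

text \<open>Since [x,y] = [x, Jy]_J and J is isometric, Cauchy-Schwarz gives the upper bound;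
  replacing x by - x gives the lower one.\<close>

lemma abs_re_form_le: "\<bar>re (form x y)\<bar> \<le> J_norm x * J_norm y"
proof -
  have *: "re (form x y) \<le> J_norm x * J_norm y" for x
    using re_J_inner_le[of x "fund_sym y"]
    by (simp add: J_inner_def fund_sym_fund_sym J_norm_fund_sym)
  have "re (form (- x) y) = - re (form x y)"
    using form_diff_left[of 0 x y] re_diff[of 0 "form x y"] by (simp add: form_0_left re_0)
  then show ?thesis
    using *[of x] *[of "- x"] by (simp add: J_norm_minus)
qed

section \<open>Closures in the norm topology and uniform definiteness\<close>

lemma closure_of_sequence:
  "x \<in> J_topology closure_of M \<longleftrightarrow> (\<exists>y. range y \<subseteq> M \<and> (\<lambda>k. J_norm (y k - x)) \<longlonglongrightarrow> 0)"
  unfolding J_topology_def J.closure_of_sequentially J.limitin_metric_dist_null by auto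

lemma subspace_closure_of:
  assumes "subspace M"
  shows "subspace (J_topology closure_of M)"
proof (rule subspaceI)
  have "(\<lambda>_. J_norm (0 - 0)) \<longlonglongrightarrow> (0::real)"
    using J_norm_eq_0_iff[of 0] by simp
  then show "0 \<in> J_topology closure_of M"
    unfolding closure_of_sequence using subspace_0[OF assms]
    by (intro exI[of _ "\<lambda>_. 0"]) auto
next
  fix x x' assume "x \<in> J_topology closure_of M" "x' \<in> J_topology closure_of M"
  then obtain y y' where y: "range y \<subseteq> M" "(\<lambda>k. J_norm (y k - x)) \<longlonglongrightarrow> 0"
    and y': "range y' \<subseteq> M" "(\<lambda>k. J_norm (y' k - x')) \<longlonglongrightarrow> 0"
    unfolding closure_of_sequence by blast
  have "(\<lambda>k. J_norm (y k + y' k - (x + x'))) \<longlonglongrightarrow> 0"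
  proof (rule Lim_null_comparison)
    show "(\<lambda>k. J_norm (y k - x) + J_norm (y' k - x')) \<longlonglongrightarrow> 0"
      using tendsto_add[OF y(2) y'(2)] by simp
    show "\<forall>\<^sub>F k in sequentially. norm (J_norm (y k + y' k - (x + x')))
        \<le> J_norm (y k - x) + J_norm (y' k - x')"
      unfolding add_diff_add by (simp add: J_norm_triangle J_norm_nonneg)
  qed
  moreover have "range (\<lambda>k. y k + y' k) \<subseteq> M"
    using y(1) y'(1) subspace_add[OF assms] by blast
  ultimately show "x + x' \<in> J_topology closure_of M"
    unfolding closure_of_sequence by blast
next
  fix a x assume "x \<in> J_topology closure_of M"
  then obtain y where y: "range y \<subseteq> M" "(\<lambda>k. J_norm (y k - x)) \<longlonglongrightarrow> 0"
    unfolding closure_of_sequence by blast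
  have "(\<lambda>k. J_norm (scl a (y k) - scl a x)) \<longlonglongrightarrow> 0"
    using tendsto_mult_left[OF y(2), of "norm a"]
    by (simp add: J_norm_scale flip: scale_right_diff_distrib)
  moreover have "range (\<lambda>k. scl a (y k)) \<subseteq> M"
    using y(1) subspace_scale[OF assms] by blast
  ultimately show "scl a x \<in> J_topology closure_of M"
    unfolding closure_of_sequence by blast
qed

lemma J_norm_tendsto:
  assumes "(\<lambda>k. J_norm (y k - x)) \<longlonglongrightarrow> 0"
  shows "(\<lambda>k. J_norm (y k)) \<longlonglongrightarrow> J_norm x"
proof -
  have "\<bar>J_norm (y k) - J_norm x\<bar> \<le> J_norm (y k - x)" for k
    using J_norm_diff_ge[of "y k" x] J_norm_diff_ge[of x "y k"] J_norm_minus_commute[of x "y k"]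
    by linarith
  then have "(\<lambda>k. J_norm (y k) - J_norm x) \<longlonglongrightarrow> 0"
    by (intro Lim_null_comparison[OF _ assms]) simp
  then show ?thesis by (rule LIM_zero_cancel)
qed

lemma re_form_self_tendsto:
  assumes "(\<lambda>k. J_norm (y k - x)) \<longlonglongrightarrow> 0"
  shows "(\<lambda>k. re (form (y k) (y k))) \<longlonglongrightarrow> re (form x x)"
proof -
  have "\<bar>re (form (y k) (y k)) - re (form x x)\<bar> \<le> J_norm (y k - x) * (J_norm (y k) + J_norm x)"
    for k
  proof -
    \<comment> \<open>As in a difference of squares, the mixed terms Re [x, y k] and Re [y k, x]
      cancel, leaving a factor y k - x in each term.\<close>
    have "re (form (y k) (y k)) - re (form x x) = re (form (y k - x) (y k)) + re (form (y k - x) x)"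
      unfolding form_diff_left re_diff re_form_commute[of x "y k"] by simp
    then show ?thesis
      using abs_re_form_le[of "y k - x" "y k"] abs_re_form_le[of "y k - x" x]
      unfolding distrib_left by linarith
  qed
  then have "\<forall>\<^sub>F k in sequentially. norm (re (form (y k) (y k)) - re (form x x))
      \<le> J_norm (y k - x) * (J_norm (y k) + J_norm x)"
    by simp
  moreover have "(\<lambda>k. J_norm (y k - x) * (J_norm (y k) + J_norm x)) \<longlonglongrightarrow> 0 * (J_norm x + J_norm x)"
    by (intro tendsto_mult tendsto_add assms J_norm_tendsto tendsto_const)
  ultimately have "(\<lambda>k. re (form (y k) (y k)) - re (form x x)) \<longlonglongrightarrow> 0"
    unfolding mult_zero_left by (rule Lim_null_comparison)
  then show ?thesis by (rule LIM_zero_cancel)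
qed

text \<open>Both sides are continuous in the norm, so the inequality survives limits with the same
  \<epsilon>. The factor s, later 1 or - 1, lets one argument serve both signs.\<close>

lemma uniform_bound_closure_of:
  assumes "\<And>x. x \<in> M \<Longrightarrow> \<epsilon> * (J_norm x)\<^sup>2 \<le> s * re (form x x)"
    and "x \<in> J_topology closure_of M"
  shows "\<epsilon> * (J_norm x)\<^sup>2 \<le> s * re (form x x)"
proof -
  obtain y where y: "range y \<subseteq> M" "(\<lambda>k. J_norm (y k - x)) \<longlonglongrightarrow> 0"
    using assms(2) unfolding closure_of_sequence by blast
  show ?thesis
  proof (rule LIMSEQ_le)
    show "(\<lambda>k. \<epsilon> * (J_norm (y k))\<^sup>2) \<longlonglongrightarrow> \<epsilon> * (J_norm x)\<^sup>2"
      by (intro tendsto_intros J_norm_tendsto y(2))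
    show "(\<lambda>k. s * re (form (y k) (y k))) \<longlonglongrightarrow> s * re (form x x)"
      by (intro tendsto_intros re_form_self_tendsto y(2))
  qed (use y(1) assms(1) in auto)
qed

text \<open>The span of A stays inside the subspace M and inherits its constant, which then passes
  to the closure.\<close>

lemma uniformly_positive_closed_span:
  assumes "uniformly_positive M" and "A \<subseteq> M"
  shows "uniformly_positive (closed_span A)"
proof -
  obtain \<epsilon> where \<epsilon>: "\<epsilon> > 0" "\<And>x. x \<in> M \<Longrightarrow> \<epsilon> * (J_norm x)\<^sup>2 \<le> 1 * re (form x x)"
    and "subspace M"
    using assms(1) unfolding uniformly_positive_def by auto
  then have "span A \<subseteq> M" using span_minimal assms(2) by blast
  then have "\<epsilon> * (J_norm x)\<^sup>2 \<le> 1 * re (form x x)" if "x \<in> closed_span A" for x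
    using \<epsilon>(2) uniform_bound_closure_of[OF _ that[unfolded closed_span_def]] by blast
  then have "\<forall>x\<in>closed_span A. re (form x x) \<ge> \<epsilon> * (J_norm x)\<^sup>2"
    by simp
  with \<epsilon>(1) show ?thesis
    unfolding uniformly_positive_def
    using subspace_closure_of[OF subspace_span, folded closed_span_def] by blast
qed

lemma uniformly_negative_closed_span:
  assumes "uniformly_negative M" and "A \<subseteq> M"
  shows "uniformly_negative (closed_span A)"
proof -
  obtain \<epsilon> where \<epsilon>: "\<epsilon> > 0" "\<And>x. x \<in> M \<Longrightarrow> \<epsilon> * (J_norm x)\<^sup>2 \<le> (- 1) * re (form x x)"
    and "subspace M"
    using assms(1) unfolding uniformly_negative_def by auto
  then have "span A \<subseteq> M" using span_minimal assms(2) by blast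
  then have "\<epsilon> * (J_norm x)\<^sup>2 \<le> (- 1) * re (form x x)" if "x \<in> closed_span A" for x
    using \<epsilon>(2) uniform_bound_closure_of[OF _ that[unfolded closed_span_def]] by blast
  then have "\<forall>x\<in>closed_span A. - re (form x x) \<ge> \<epsilon> * (J_norm x)\<^sup>2"
    by simp
  with \<epsilon>(1) show ?thesis
    unfolding uniformly_negative_def
    using subspace_closure_of[OF subspace_span, folded closed_span_def] by blast
qed

section \<open>The synthesis operator and subsequences of a frame\<close>

lemma synthesis_unit:
  "synthesis f (\<lambda>j. if j = i then 1 else 0) = f i"
proof -
  have "(\<Sum>j<N. scl (if j = i then 1 else 0) (f j)) = f i" if "N > i" for N
  proof -
    have "(\<Sum>j<N. scl (if j = i then 1 else 0) (f j)) = (\<Sum>j<N. if j = i then f i else 0)"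
      by (intro sum.cong) auto
    then show ?thesis using that by simp
  qed
  \<comment> \<open>The partial sums run over j < N, so they equal \<open>f i\<close> as soon as N >
    i; being eventually constant, they converge. Uniqueness of metric limits then evaluates the
    description in \<open>synthesis\<close>.\<close>
  then have "\<forall>\<^sub>F N in sequentially. (\<Sum>j<N. scl (if j = i then 1 else 0) (f j)) = f i"
    by (intro eventually_mono[OF eventually_gt_at_top[of i]])
  then have lim: "limitin J.mtopology (\<lambda>N. \<Sum>j<N. scl (if j = i then 1 else 0) (f j)) (f i) sequentially"
    by (rule limitin_eventually[rotated]) simp
  show ?thesis
    unfolding synthesis_def J_topology_def
  proof (rule the_equality)
    show "x = f i"
      if "limitin J.mtopology (\<lambda>N. \<Sum>j<N. scl (if j = i then 1 else 0) (f j)) x sequentially" for x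
      using J.limitin_metric_unique[OF that lim trivial_limit_sequentially] .
  qed (rule lim)
qed

lemma frame_vector_in_range:
  assumes "i \<in> A"
  shows "f i \<in> (synthesis f \<circ> coord_proj A) ` ell2"
proof
  let ?e = "\<lambda>j. if j = i then 1 else 0 :: 'f"
  have "coord_proj A ?e = ?e"
    using assms by (auto simp: coord_proj_def fun_eq_iff)
  then show "f i = (synthesis f \<circ> coord_proj A) ?e"
    by (simp only: o_apply synthesis_unit)
  have "summable (\<lambda>j. (norm (?e j))\<^sup>2)"
    by (rule summable_finite[of "{i}"]) auto
  then show "?e \<in> ell2"
    by (simp only: ell2_def mem_Collect_eq)
qed

text \<open>A strictly increasing m is injective, so the reindexed series collects some of the
  nonnegative terms of the original one, and the same bound C works.\<close>

lemma bessel_subseq: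
  assumes "bessel f" and "strict_mono m"
  shows "bessel (f \<circ> m)"
proof -
  obtain C where C: "\<And>x. summable (\<lambda>i. (norm (J_inner x (f i)))\<^sup>2)"
    "\<And>x. (\<Sum>i. (norm (J_inner x (f i)))\<^sup>2) \<le> C * (J_norm x)\<^sup>2"
    using assms(1) unfolding bessel_def by blast
  have inj: "inj m" using assms(2) by (rule strict_mono_imp_inj_on)
  have "summable (\<lambda>i. (norm (J_inner x ((f \<circ> m) i)))\<^sup>2)" for x
    using summable_reindex[OF C(1)[of x] inj] by (simp add: o_def)
  moreover have "(\<Sum>i. (norm (J_inner x ((f \<circ> m) i)))\<^sup>2) \<le> C * (J_norm x)\<^sup>2" for x
    using suminf_reindex_mono[OF C(1)[of x] inj] C(2)[of x] by (simp add: o_def)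
  ultimately show ?thesis unfolding bessel_def by blast
qed

text \<open>The vectors of the subsequence with positive square lie in \<open>Mp\<close> and those
  with negative square in \<open>Mm\<close>. Their closed spans therefore inherit uniform
  definiteness from these ranges.\<close>

lemma J_frame_sequence_subseq:
  assumes "J_frame f" and "strict_mono m"
  shows "J_frame_sequence (f \<circ> m)"
proof -
  define Mp where "Mp = (synthesis f \<circ> coord_proj (I_plus f)) ` ell2"
  define Mm where "Mm = (synthesis f \<circ> coord_proj (I_minus f)) ` ell2"
  have b: "bessel f" and pos: "uniformly_positive Mp" and neg: "uniformly_negative Mm"
    using assms(1)
    unfolding J_frame_def maximal_uniformly_positive_def maximal_uniformly_negative_def
      Mp_def Mm_def by auto
  have Mp: "f i \<in> Mp" if "re (form (f i) (f i)) \<ge> 0" for i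
    unfolding Mp_def using that by (intro frame_vector_in_range) (simp add: I_plus_def)
  have Mm: "f i \<in> Mm" if "re (form (f i) (f i)) < 0" for i
    unfolding Mm_def using that by (intro frame_vector_in_range) (simp add: I_minus_def)
  \<comment> \<open>The index set \<open>I_plus\<close> includes square 0, so a neutral frame vector
    lies in \<open>Mp\<close>; there \<epsilon> times its squared norm is at most 0, which forces it
    to vanish.\<close>
  have "f i = 0" if "form (f i) (f i) = 0" for i
  proof -
    obtain \<epsilon> where "\<epsilon> > 0" "\<And>x. x \<in> Mp \<Longrightarrow> \<epsilon> * (J_norm x)\<^sup>2 \<le> re (form x x)"
      using pos unfolding uniformly_positive_def by auto
    with Mp[of i] that have "\<epsilon> * (J_norm (f i))\<^sup>2 \<le> 0"
      by (metis order_refl re_0)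
    with \<open>\<epsilon> > 0\<close> show ?thesis
      by (simp add: mult_le_0_iff J_norm_eq_0_iff)
  qed
  moreover have "uniformly_positive
      (closed_span {(f \<circ> m) i | i. re (form ((f \<circ> m) i) ((f \<circ> m) i)) > 0})"
    by (rule uniformly_positive_closed_span[OF pos]) (auto intro: Mp)
  moreover have "uniformly_negative
      (closed_span {(f \<circ> m) i | i. re (form ((f \<circ> m) i) ((f \<circ> m) i)) < 0})"
    by (rule uniformly_negative_closed_span[OF neg]) (auto intro: Mm)
  ultimately show ?thesis
    unfolding J_frame_sequence_def using bessel_subseq[OF b assms(2)] by auto
qed

end

theorem theorem3p12:
  fixes scl :: "'f::real_or_complex \<Rightarrow> 'v::ab_group_add \<Rightarrow> 'v"
    and form :: "'v \<Rightarrow> 'v \<Rightarrow> 'f"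
    and Kp Km K' :: "'v set"
    and f :: "nat \<Rightarrow> 'v"
    and m n :: "nat \<Rightarrow> nat"
  assumes "krein_space scl form Kp Km"
    and "krein_space.J_frame scl form Kp Km f"
    and "strict_mono m" and "strict_mono n"
    and "range m \<union> range n = UNIV"
    and "K' = krein_space.closed_span scl form Kp Km (range (f \<circ> m)) \<inter>
              krein_space.closed_span scl form Kp Km (range (f \<circ> n))"
    and "krein_space_on scl form K'"
    and "\<exists>B. finite B \<and> module.span scl B = K'"
  shows "krein_space.J_frame_sequence scl form Kp Km (f \<circ> m) \<and>
         krein_space.J_frame_sequence scl form Kp Km (f \<circ> n)"
proof -
  interpret krein_space scl form Kp Km by (rule assms(1))
  show ?thesis
    using J_frame_sequence_subseq assms(2-4) by blast
qed

end
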